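(* Let $S\subseteq\mathbb N$ be a numerical semigroup of genus $g\ge 2$, and let $G=\mathbb N\setminus S$. Then the Buchweitz set $$\mathrm{B}(S)=\{n\ge 2 \mid |nG| > (2n-1)(|G|-1)\}$$ is finite.
   Context: $\mathbb N=\{0,1,2,\dots\}$. A numerical semigroup is a subset $S\subseteq\mathbb N$ containing $0$, closed under addition, with finite complement $\mathbb N\setminus S$ (the gapset); its genus is $|\mathbb N\setminus S|$. For a finite set $A\subset\mathbb Z$ and $n\ge1$, $nA$ is the $n$-fold sumset: $1A=A$, $nA=A+(n-1)A$, where $X+Y=\{x+y\mid x\in X, y\in Y\}$. *)

theory Defs
  imports Complex_Main "HOL-Library.Set_Algebras"
begin

definition numerical_semigroup :: "nat set \<Rightarrow> bool" where
  "numerical_semigroup S \<longleftrightarrow>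
     0 \<in> S \<and> (\<forall>x\<in>S. \<forall>y\<in>S. x + y \<in> S) \<and> finite (UNIV - S)"

definition gapset :: "nat set \<Rightarrow> nat set" where
  "gapset S = UNIV - S"

definition genus :: "nat set \<Rightarrow> nat" where
  "genus S = card (gapset S)"

text \<open>The addition of sets is the Minkowski sum. The value at \<open>0\<close> is the usual
  convention; it makes the recursion yield \<open>1A = A\<close>.\<close>

primrec nfold_sumset :: "nat \<Rightarrow> 'a::comm_monoid_add set \<Rightarrow> 'a set" where
  "nfold_sumset 0 A = {0}"
| "nfold_sumset (Suc n) A = A + nfold_sumset n A"

lemma nfold_sumset_1: "nfold_sumset 1 A = A"
  by (auto simp: set_plus_def)

text \<open>The inequality is stated in the integers, so that no subtraction is truncated.\<close>

definition buchweitz_set :: "nat set \<Rightarrow> nat set" where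
  "buchweitz_set S =
     {n. n \<ge> 2 \<and>
         int (card (nfold_sumset n (gapset S))) > (2 * int n - 1) * (int (card (gapset S)) - 1)}"

end

theory Submission
  imports Defs
begin

text \<open>Let \<open>f\<close> be the largest gap. Since \<open>x \<mapsto> f - x\<close> maps the elements of \<open>S\<close> below \<open>f\<close>
  injectively to gaps, \<open>f \<le> 2g - 1\<close>. As \<open>nG \<subseteq> [n, nf]\<close>, the case \<open>f \<le> 2g - 2\<close> gives
  \<open>\<bar>nG\<bar> \<le> n(2g - 3) + 1\<close>, which suffices for \<open>n \<ge> g\<close>. If \<open>f = 2g - 1\<close>, then counting turns the
  injection into a bijection, so \<open>f - G \<subseteq> S\<close> and hence \<open>nf - nG \<subseteq> S\<close>. Thus \<open>nG\<close> misses the \<open>g\<close>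
  elements \<open>nf - y\<close>, \<open>y \<in> G\<close>, of \<open>[n, nf]\<close>, which is exactly enough for every \<open>n \<ge> 2\<close>.\<close>

lemma nfold_sumset_subset_interval:
  fixes A :: "nat set"
  assumes "A \<subseteq> {a..b}"
  shows "nfold_sumset n A \<subseteq> {n * a..n * b}"
proof (induction n)
  case (Suc n)
  show ?case
  proof
    fix x assume "x \<in> nfold_sumset (Suc n) A"
    then obtain y z where "x = y + z" "y \<in> A" "z \<in> nfold_sumset n A"
      by (auto simp: set_plus_def)
    moreover from this have "a \<le> y" "y \<le> b" "n * a \<le> z" "z \<le> n * b"
      using assms Suc by auto
    ultimately show "x \<in> {Suc n * a..Suc n * b}" by auto
  qed
qed simp

text \<open>Subtracting a sum of \<open>n\<close> elements of \<open>A\<close> from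
  \<open>n * f\<close> amounts to adding their \<open>n\<close> reflections \<open>f - x\<close>.
  All of these are at most \<open>f\<close>, so no subtraction truncates.\<close>

lemma diff_nfold_sumset_mem:
  fixes A S :: "nat set"
  assumes "0 \<in> S" and add: "\<And>x y. x \<in> S \<Longrightarrow> y \<in> S \<Longrightarrow> x + y \<in> S"
    and le: "A \<subseteq> {..f}" and diff: "\<And>x. x \<in> A \<Longrightarrow> f - x \<in> S"
    and "x \<in> nfold_sumset n A"
  shows "n * f - x \<in> S"
  using \<open>x \<in> nfold_sumset n A\<close>
proof (induction n arbitrary: x)
  case (Suc n)
  then obtain y z where x: "x = y + z" and y: "y \<in> A" and z: "z \<in> nfold_sumset n A"
    by (auto simp: set_plus_def)
  have "y \<le> f" using y le by auto
  moreover have "z \<le> n * f"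
    using nfold_sumset_subset_interval[of A 0 f n] le z by (auto simp: atMost_atLeast0)
  ultimately have "Suc n * f - x = (f - y) + (n * f - z)" using x by simp
  then show ?case using add diff[OF y] Suc.IH[OF z] by simp
qed (use \<open>0 \<in> S\<close> in simp)

lemma finite_gapset: "numerical_semigroup S \<Longrightarrow> finite (gapset S)"
  by (simp add: numerical_semigroup_def gapset_def)

lemma reflect_mem_gapset:
  assumes "numerical_semigroup S" "f \<in> gapset S" "x \<in> S" "x \<le> f"
  shows "f - x \<in> gapset S"
proof (rule ccontr)
  assume "f - x \<notin> gapset S"
  then have "f - x \<in> S" by (simp add: gapset_def)
  then have "x + (f - x) \<in> S" using assms(1,3) by (simp add: numerical_semigroup_def)
  then show False using assms(2,4) by (simp add: gapset_def)
qed

lemma inj_on_diff_left: "inj_on ((-) f) {..f::nat}"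
  by (rule inj_onI) (metis atMost_iff diff_diff_cancel)

lemma card_semigroup_atMost:
  assumes "finite (gapset S)" "gapset S \<subseteq> {..f}"
  shows "card (S \<inter> {..f}) + genus S = Suc f"
proof -
  have "{..f} = (S \<inter> {..f}) \<union> gapset S" using assms(2) by (auto simp: gapset_def)
  moreover have "(S \<inter> {..f}) \<inter> gapset S = {}" by (auto simp: gapset_def)
  ultimately show ?thesis
    using card_Un_disjoint[of "S \<inter> {..f}" "gapset S"] assms(1) by (simp add: genus_def)
qed

lemma
  assumes S: "numerical_semigroup S" and f: "f \<in> gapset S" and le: "gapset S \<subseteq> {..f}"
  shows frobenius_le: "f < 2 * genus S"
    and frobenius_symmetric: "Suc f = 2 * genus S \<Longrightarrow> y \<in> gapset S \<Longrightarrow> f - y \<in> S"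
proof -
  let ?T = "S \<inter> {..f}"
  have sub: "(-) f ` ?T \<subseteq> gapset S" using reflect_mem_gapset[OF S f] by auto
  have card: "card ((-) f ` ?T) = card ?T"
    by (intro card_image inj_on_subset[OF inj_on_diff_left]) auto
  have sum: "card ?T + genus S = Suc f"
    by (rule card_semigroup_atMost[OF finite_gapset[OF S] le])
  have "card ?T \<le> genus S"
    using card_mono[OF finite_gapset[OF S] sub] card by (simp add: genus_def)
  \<comment> \<open>\<open>{..f}\<close> has \<open>f + 1\<close> elements, as it contains 0; this
    makes the bound strict.\<close>
  then show "f < 2 * genus S" using sum by simp
  assume "Suc f = 2 * genus S" and y: "y \<in> gapset S"
  then have "card ((-) f ` ?T) = card (gapset S)" using card sum by (simp add: genus_def)
  then have "(-) f ` ?T = gapset S"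
    by (rule card_subset_eq[OF finite_gapset[OF S] sub])
  then obtain x where "x \<in> S" "x \<le> f" "y = f - x" using y by auto
  then show "f - y \<in> S" by simp
qed

theorem theorem3p3:
  fixes S :: "nat set"
  assumes "numerical_semigroup S"
    and "genus S \<ge> 2"
  shows "finite (buchweitz_set S)"
proof -
  note S = assms(1)
  define G g f where "G = gapset S" and "g = genus S" and "f = Max G"
  have fin: "finite G" using finite_gapset[OF S] by (simp add: G_def)
  have cardG: "card G = g" by (simp add: G_def g_def genus_def)
  have g: "g \<ge> 2" using assms(2) by (simp add: g_def)
  then have "G \<noteq> {}" using cardG by auto
  then have f: "f \<in> G" using fin by (simp add: f_def)
  have le: "G \<subseteq> {..f}" using fin by (auto simp: f_def)
  have "0 \<notin> G" using S by (simp add: G_def gapset_def numerical_semigroup_def)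
  have G1: "G \<subseteq> {1..f}"
  proof
    fix x assume "x \<in> G"
    then show "x \<in> {1..f}" using le \<open>0 \<notin> G\<close> by (cases x) auto
  qed
  \<comment> \<open>With \<open>g \<ge> 2\<close> this gives \<open>f \<ge> 2\<close>, so
    \<open>{n..n * f}\<close> is nonempty.\<close>
  have "g \<le> f" using card_mono[OF _ G1] cardG by simp
  have "f < 2 * g" using frobenius_le[OF S] f le by (simp add: G_def g_def)
  have "int (card (nfold_sumset n G)) \<le> (2 * int n - 1) * (int g - 1)"
    if n: "n \<ge> g" for n
  proof -
    have sub: "nfold_sumset n G \<subseteq> {n..n * f}"
      using nfold_sumset_subset_interval[OF G1, of n] by simp
    have card_int: "int (card {n..n * f}) = int n * int f - int n + 1"
      using \<open>g \<le> f\<close> g by (cases f) (auto simp: of_nat_diff algebra_simps)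
    show ?thesis
    proof (cases "Suc f = 2 * g")
      case True
      let ?R = "(\<lambda>y. n * f - y) ` G"
      have "f \<le> n * f" using n g by simp
      \<comment> \<open>As \<open>2 * (n - 1) \<ge> n\<close>, every reflected gap satisfies
        \<open>n * f - y \<ge> n * f - f \<ge> n\<close>.\<close>
      have "(n - 1) * f \<ge> (n - 1) * 2" using \<open>g \<le> f\<close> g by (intro mult_le_mono2) simp
      then have low: "n * f \<ge> n + f" using n g by (simp add: diff_mult_distrib)
      have "?R \<subseteq> {n..n * f}" using low le by fastforce
      moreover have "card ?R = g"
      proof -
        have "G \<subseteq> {..n * f}" using le \<open>f \<le> n * f\<close> by (meson atMost_subset_iff order_trans)
        then show ?thesis
          using card_image[OF inj_on_subset[OF inj_on_diff_left]] cardG by blast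
      qed
      moreover have "nfold_sumset n G \<subseteq> {n..n * f} - ?R"
      proof
        fix x assume x: "x \<in> nfold_sumset n G"
        have "n * f - x \<in> S"
          using S x le frobenius_symmetric[OF S, of f] f True
          by (intro diff_nfold_sumset_mem[of S G f x n])
            (auto simp: numerical_semigroup_def G_def g_def)
        \<comment> \<open>Reflecting twice returns the gap \<open>y\<close>, because
          \<open>y \<le> f \<le> n * f\<close>.\<close>
        moreover have "n * f - (n * f - y) \<notin> S" if "y \<in> G" "x = n * f - y" for y
          using that calculation le \<open>f \<le> n * f\<close>
          by (metis G_def gapset_def Diff_iff atMost_iff diff_diff_cancel le_trans subsetD)
        ultimately have "x \<notin> ?R" by auto
        then show "x \<in> {n..n * f} - ?R" using sub x by auto
      qed
      ultimately have "int (card (nfold_sumset n G)) \<le> int (card {n..n * f}) - int g"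
        \<comment> \<open>The second instance shows that the interval has at least \<open>g\<close>
          elements, so the difference of cardinalities is not truncated.\<close>
        using card_mono[of "{n..n * f} - ?R" "nfold_sumset n G"] card_mono[of "{n..n * f}" ?R] fin
        by (simp add: card_Diff_subset)
      also have "\<dots> = (2 * int n - 1) * (int g - 1)"
      proof -
        have f_eq: "int f = 2 * int g - 1" using True by simp
        show ?thesis unfolding card_int f_eq by (simp add: algebra_simps)
      qed
      finally show ?thesis .
    next
      case False
      then have "int f \<le> 2 * int g - 2" using \<open>f < 2 * g\<close> by linarith
      then have "int n * int f \<le> int n * (2 * int g - 2)" by (intro mult_left_mono) auto
      moreover have "int (card (nfold_sumset n G)) \<le> int n * int f - int n + 1"
        using card_mono[OF _ sub] card_int by simp
      moreover have "int n \<ge> int g" using n by simp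
      \<comment> \<open>The threshold \<open>n \<ge> g\<close> comes from here:
        \<open>(2n - 1)(g - 1)\<close> exceeds \<open>n(2g - 3) + 1\<close> by exactly
        \<open>n - g\<close>.\<close>
      ultimately show ?thesis by (simp add: algebra_simps)
    qed
  qed
  then have "buchweitz_set S \<subseteq> {..<g}"
    using cardG unfolding buchweitz_set_def G_def[symmetric] by (auto simp flip: not_le)
  then show ?thesis by (rule finite_subset) simp
qed

end
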